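(* Let $\Bbbk$ be a field. For all integers $n\ge2$ and $1\le q\le\nu(F_n)=\lceil n/2\rceil$, where $F_n$ is the fan graph on $\{x_1,\ldots,x_n,v\}$ and $R=\Bbbk[x_1,\ldots,x_n,v]$, the Krull dimension satisfies \[ \dim\big(R/I(F_n)^{[q]}\big)=\Big\lceil\frac n2\Big\rceil+q-1 . \]
   Context: The fan graph $F_n$ has vertices $x_1,\ldots,x_n,v$, with edges $x_ix_{i+1}$ for $1\le i\le n-1$ and edges $vx_i$ for $1\le i\le n$. $\nu(X)$ denotes the matching number of a graph $X$ (maximum number of pairwise vertex-disjoint edges). A $q$-matching is a set $M$ of $q$ pairwise vertex-disjoint edges, and $V(M)$ is the set of vertices it covers. For a graph $X$, the $q$-th squarefree power $I(X)^{[q]}$ is the ideal, in the polynomial ring over $\Bbbk$ whose variables are the vertices of $X$, generated by all monomials $\prod_{u\in V(M)}u$ with $M$ a $q$-matching of $X$. *)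

theory Defs
  imports
    "HOL-Algebra.QuotRing"
    "HOL-Library.Poly_Mapping"
    "HOL-Library.Extended_Nat"
begin

section \<open>Finite simple graphs and matchings\<close>

text \<open>An edge is the two-element set of its endpoints.\<close>

record 'v graph =
  verts :: "'v set"
  edges :: "'v set set"

definition is_matching :: "'v graph \<Rightarrow> nat \<Rightarrow> 'v set set \<Rightarrow> bool" where
  "is_matching G q M \<longleftrightarrow>
     M \<subseteq> edges G \<and> finite M \<and> card M = q \<and> pairwise disjnt M"

text \<open>For a finite edge set this is a maximum over a finite set containing \<open>0\<close>.\<close>

definition matching_number :: "'v graph \<Rightarrow> nat" where
  "matching_number G = Max {q. \<exists>M. is_matching G q M}"

text \<open>\<open>Rim i\<close> is the vertex \<open>x\<^sub>i\<close> and \<open>Hub\<close> is the vertex \<open>v\<close>.\<close>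

datatype fan_vertex = Rim nat | Hub

definition fan_graph :: "nat \<Rightarrow> fan_vertex graph" where
  "fan_graph n =
     \<lparr> verts = insert Hub (Rim ` {1..n}),
       edges = {{Rim i, Rim (i + 1)} | i. 1 \<le> i \<and> i + 1 \<le> n}
             \<union> {{Hub, Rim i} | i. 1 \<le> i \<and> i \<le> n} \<rparr>"


section \<open>Polynomial rings and squarefree powers\<close>

text \<open>
  A monomial is a finitely supported exponent function, and a polynomial is a finitely
  supported coefficient function on monomials; multiplication on this type is convolution.
\<close>

type_synonym ('v, 'k) mpolynomial = "('v \<Rightarrow>\<^sub>0 nat) \<Rightarrow>\<^sub>0 'k"

definition indet :: "'v \<Rightarrow> ('v, 'k::comm_ring_1) mpolynomial" where
  "indet u = Poly_Mapping.single (Poly_Mapping.single u 1) 1"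

text \<open>The ring of polynomials in which only the variables in \<open>V\<close> occur.\<close>

definition polynomial_ring :: "'v set \<Rightarrow> ('v, 'k::comm_ring_1) mpolynomial ring" where
  "polynomial_ring V =
     \<lparr> carrier = {p. \<forall>m \<in> Poly_Mapping.keys p. Poly_Mapping.keys m \<subseteq> V},
       mult = (*), one = 1, zero = 0, add = (+) \<rparr>"

definition squarefree_power :: "'v graph \<Rightarrow> nat \<Rightarrow> ('v, 'k::comm_ring_1) mpolynomial set" where
  "squarefree_power G q =
     genideal (polynomial_ring (verts G)) {\<Prod>u\<in>(\<Union>M). indet u | M. is_matching G q M}"


section \<open>Krull dimension\<close>

text \<open>
  The supremum of the lengths of strictly ascending chains of prime ideals, a chain
  \<open>P 0 \<subset> \<dots> \<subset> P l\<close> having length \<open>l\<close>. In \<^typ>\<open>enat\<close> the zero ring,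
  which has no prime ideals, gets dimension \<open>0\<close>.
\<close>

definition krull_dim :: "('a, 'b) ring_scheme \<Rightarrow> enat" where
  "krull_dim R =
     (SUP l \<in> {l. \<exists>P. (\<forall>i\<le>l. primeideal (P i) R) \<and> (\<forall>i<l. P i \<subset> P (Suc i))}. enat l)"

end

theory Submission
  imports Defs
begin

text \<open>
  Let \<open>I\<close> be an ideal generated by squarefree monomials with supports in a family \<open>\<A>\<close> of
  subsets of the finite variable set \<open>V\<close>. The dimension of \<open>k[V]/I\<close> is the largest size of a
  set \<open>W \<subseteq> V\<close> that contains no member of \<open>\<A>\<close> (theorem \<open>krull_dim_squarefree_quotient\<close>).
  For the squarefree power of a graph the family consists of the vertex sets of
  \<open>q\<close>-matchings, so the question becomes how many vertices of the fan can be chosen without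
  capturing a \<open>q\<close>-matching.

  \<^bold>\<open>Lower bound on the dimension.\<close> Given such a \<open>W\<close>, the ideal generated by the variables outside
  \<open>W\<close> is a prime containing \<open>I\<close>, and adjoining the variables of \<open>W\<close> one at a time gives a chain
  of primes of length \<open>card W\<close>.

  \<^bold>\<open>Upper bound on the dimension.\<close> Take a chain of primes \<open>P\<^sub>0 \<subset> \<dots> \<subset> P\<^sub>l\<close> above \<open>I\<close> and let \<open>W\<close> be
  the set of variables outside \<open>P\<^sub>0\<close>. As \<open>P\<^sub>0\<close> is prime, it contains a variable of every
  generator, so \<open>W\<close> contains no member of \<open>\<A>\<close>, and it remains to see \<open>l \<le> card W\<close>. Choose
  \<open>f\<^sub>i \<in> P\<^sub>i\<^sub>+\<^sub>1 - P\<^sub>i\<close>; modulo \<open>P\<^sub>0\<close> these may be taken to be polynomials in the variables \<open>W\<close>. They are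
  algebraically independent modulo \<open>P\<^sub>0\<close> (lemma \<open>chain_elements_independent\<close>): in a relation
  \<open>\<Sum>\<^sub>j f\<^sub>0\<^sup>j G\<^sub>j(f\<^sub>1, f\<^sub>2, \<dots>) \<in> P\<^sub>0\<close> the lowest power of \<open>f\<^sub>0\<close> can be cancelled, after which reducing
  modulo \<open>P\<^sub>1\<close> leaves a relation among \<open>f\<^sub>1, f\<^sub>2, \<dots>\<close>. Consequently the \<open>N\<^sup>l\<close> products of powers of
  the \<open>f\<^sub>i\<close> with exponents below \<open>N\<close> are linearly independent over \<open>k\<close>. They lie in the span of the
  monomials in \<open>W\<close> whose exponents are \<open>O(N)\<close>, a space of dimension \<open>O(N\<^sup>w)\<close> for \<open>w = card W\<close>;
  letting \<open>N\<close> grow yields \<open>l \<le> w\<close>.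

  \<^bold>\<open>The fan.\<close> Put \<open>h = \<lceil>n/2\<rceil>\<close>. The alternate rim vertices \<open>x\<^sub>1, x\<^sub>3, \<dots>\<close> form an independent set of
  size \<open>h\<close>; together with any \<open>q - 1\<close> further vertices they contain no \<open>q\<close>-matching, because each
  edge of a matching uses up one of the further vertices. Conversely, if \<open>n\<close> is odd the fan has a
  perfect matching with \<open>h\<close> edges, and if \<open>n\<close> is even it has one after the deletion of any single
  vertex. Hence the matching number is \<open>h\<close>, as \<open>2h + 2\<close> exceeds the number of vertices. If at least
  \<open>h + q\<close> vertices are chosen, where \<open>q \<le> h\<close>, it may be assumed that all of them are matched: for even
  \<open>n\<close> delete a vertex that is not chosen, or give up one if everything is chosen. As there are only \<open>h\<close>
  edges, both ends of at least \<open>q\<close> of them are then chosen. So the maximum is \<open>h + q - 1\<close>.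
\<close>

section \<open>Polynomials through their monomials\<close>

alias keys = Poly_Mapping.keys
alias lookup = Poly_Mapping.lookup
alias single = Poly_Mapping.single

lemma mpolynomial_eq_sum_monomials:
  fixes p :: "'m \<Rightarrow>\<^sub>0 'k::comm_monoid_add"
  shows "p = (\<Sum>m\<in>keys p. single m (lookup p m))"
  by (rule poly_mapping_eqI)
     (auto simp: lookup_sum lookup_single when_def in_keys_iff sum.delta)

text \<open>
  With the exponents that avoid a given set of variables as \<open>X\<close>, this replaces reduction modulo the
  ideal generated by those variables: \<open>r\<close> avoids them and \<open>s\<close> lies in the ideal.
\<close>

lemma split_by_monomials:
  fixes p :: "'m \<Rightarrow>\<^sub>0 'k::comm_monoid_add"
  obtains r s where "p = r + s" "keys r \<subseteq> keys p \<inter> X"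
    "keys s \<subseteq> keys p - X"
proof
  let ?m = "\<lambda>m. single m (lookup p m)"
  have "(\<Sum>m\<in>keys p \<inter> X. ?m m) + (\<Sum>m\<in>keys p - X. ?m m)
      = (\<Sum>m\<in>keys p. ?m m)"
    by (subst sum.union_disjoint[symmetric]) (auto intro: sum.cong)
  then show "p = (\<Sum>m\<in>keys p \<inter> X. ?m m) + (\<Sum>m\<in>keys p - X. ?m m)"
    using mpolynomial_eq_sum_monomials[of p] by simp
  have sub: "keys (sum ?m Y) \<subseteq> Y" for Y
  proof -
    have "keys (sum ?m Y) \<subseteq> (\<Union>m\<in>Y. keys (?m m))"
      by (rule Poly_Mapping.keys_sum)
    also have "\<dots> \<subseteq> Y" by (auto split: if_splits)
    finally show ?thesis .
  qed
  show "keys (sum ?m (keys p \<inter> X)) \<subseteq> keys p \<inter> X"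
    "keys (sum ?m (keys p - X)) \<subseteq> keys p - X"
    by (rule sub)+
qed

lemma keys_add_nat:
  "keys (a + b :: 'v \<Rightarrow>\<^sub>0 nat) = keys a \<union> keys b"
  by (auto simp: in_keys_iff lookup_add)

lemma keys_uminus: "keys (- p :: 'm \<Rightarrow>\<^sub>0 'k::ab_group_add) = keys p"
  by (auto simp: in_keys_iff)

lemma keys_mult_elim:
  fixes p q :: "('v, 'k::comm_ring_1) mpolynomial"
  assumes "m \<in> keys (p * q)"
  obtains a b where "a \<in> keys p" "b \<in> keys q" "m = a + b"
  using assms Poly_Mapping.keys_mult[of p q] by blast

definition supported :: "('v \<Rightarrow>\<^sub>0 nat) set \<Rightarrow> ('v, 'k::comm_ring_1) mpolynomial set" where
  "supported X = {p. keys p \<subseteq> X}"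

lemma supported_mono: "X \<subseteq> Y \<Longrightarrow> supported X \<subseteq> supported Y"
  by (auto simp: supported_def)

lemma supported_uminus: "p \<in> supported X \<Longrightarrow> - p \<in> supported X"
  by (simp add: supported_def keys_uminus)

lemma supported_add: "p \<in> supported X \<Longrightarrow> q \<in> supported X \<Longrightarrow> p + q \<in> supported X"
  using Poly_Mapping.keys_add[of p q] unfolding supported_def by blast

lemma supported_zero: "0 \<in> supported X"
  by (simp add: supported_def)

lemma supported_sum: "(\<And>i. i \<in> A \<Longrightarrow> p i \<in> supported X) \<Longrightarrow> (\<Sum>i\<in>A. p i) \<in> supported X"
  by (induction A rule: infinite_finite_induct) (auto intro: supported_add supported_zero)

lemma supported_single: "m \<in> X \<Longrightarrow> single m c \<in> supported X"
  by (simp add: supported_def)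

lemma supported_mult:
  assumes "p \<in> supported X" "q \<in> supported Y" "\<And>a b. a \<in> X \<Longrightarrow> b \<in> Y \<Longrightarrow> a + b \<in> Z"
  shows "p * q \<in> supported Z"
  using assms unfolding supported_def by (blast elim: keys_mult_elim)

definition monomials_in :: "'v set \<Rightarrow> ('v \<Rightarrow>\<^sub>0 nat) set" where
  "monomials_in V = {m. keys m \<subseteq> V}"

abbreviation polys_in :: "'v set \<Rightarrow> ('v, 'k::comm_ring_1) mpolynomial set" where
  "polys_in V \<equiv> supported (monomials_in V)"

lemma polys_in_one: "1 \<in> polys_in V"
  by (simp add: supported_def monomials_in_def)

lemma polys_in_const: "single 0 c \<in> polys_in V"
  by (rule supported_single) (simp add: monomials_in_def)

lemma polys_in_mult: "p \<in> polys_in V \<Longrightarrow> q \<in> polys_in V \<Longrightarrow> p * q \<in> polys_in V"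
  by (erule (1) supported_mult) (simp add: monomials_in_def keys_add_nat)

lemma polys_in_power: "p \<in> polys_in V \<Longrightarrow> p ^ e \<in> polys_in V"
  by (induction e) (simp_all add: polys_in_one polys_in_mult)

lemma polys_in_prod: "(\<And>i. i \<in> A \<Longrightarrow> p i \<in> polys_in V) \<Longrightarrow> (\<Prod>i\<in>A. p i) \<in> polys_in V"
  by (induction A rule: infinite_finite_induct) (simp_all add: polys_in_one polys_in_mult)

lemma polys_in_indet: "u \<in> V \<Longrightarrow> indet u \<in> polys_in V"
  unfolding indet_def by (rule supported_single) (simp add: monomials_in_def)

lemma polynomial_ring_simps [simp]:
  "carrier (polynomial_ring V) = polys_in V"
  "p \<otimes>\<^bsub>polynomial_ring V\<^esub> q = p * q"
  "p \<oplus>\<^bsub>polynomial_ring V\<^esub> q = p + q"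
  "\<one>\<^bsub>polynomial_ring V\<^esub> = 1"
  "\<zero>\<^bsub>polynomial_ring V\<^esub> = 0"
  by (auto simp: polynomial_ring_def supported_def monomials_in_def)

lemma cring_polynomial_ring: "cring (polynomial_ring V :: ('v, 'k::comm_ring_1) mpolynomial ring)"
proof (rule cringI)
  show "abelian_group (polynomial_ring V :: ('v, 'k) mpolynomial ring)"
  proof (rule abelian_groupI)
    fix x assume x: "x \<in> carrier (polynomial_ring V :: ('v, 'k) mpolynomial ring)"
    show "\<exists>y\<in>carrier (polynomial_ring V). y \<oplus>\<^bsub>polynomial_ring V\<^esub> x = \<zero>\<^bsub>polynomial_ring V\<^esub>"
      by (rule bexI[of _ "- x"]) (use x in \<open>simp_all add: supported_uminus\<close>)
  qed (simp_all add: supported_add supported_zero add_ac)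
  show "Group.comm_monoid (polynomial_ring V :: ('v, 'k) mpolynomial ring)"
    by (rule comm_monoidI) (simp_all add: polys_in_mult polys_in_one mult_ac)
qed (simp add: distrib_right)

section \<open>Prime ideals of polynomial rings and of quotients\<close>

lemma one_in_prime_ideal:
  assumes "primeideal P R" shows "\<one>\<^bsub>R\<^esub> \<notin> P"
  using assms ideal.one_imp_carrier primeideal.I_notcarr primeideal.axioms(1) by blast

text \<open>
  The ideal correspondence theorem restricted to primes: it allows all chains to be studied in
  the polynomial ring itself.
\<close>

lemma (in cring) quot_prime_chain_iff:
  assumes I: "ideal I R"
  shows "(\<exists>Q. (\<forall>i\<le>l. primeideal (Q i) (R Quot I)) \<and> (\<forall>i<l. Q i \<subset> Q (Suc i)))
    \<longleftrightarrow> (\<exists>P. (\<forall>i\<le>(l::nat). primeideal (P i) R \<and> I \<subseteq> P i) \<and> (\<forall>i<l. P i \<subset> P (Suc i)))"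
    (is "?lhs \<longleftrightarrow> ?rhs")
proof
  assume ?lhs
  then obtain Q where Q: "\<And>i. i \<le> l \<Longrightarrow> primeideal (Q i) (R Quot I)"
    and chain: "\<And>i. i < l \<Longrightarrow> Q i \<subset> Q (Suc i)" by blast
  interpret proj: ring_hom_ring R "R Quot I" "(+>) I"
    by (rule ideal.rcos_ring_hom_ring[OF I])
  have idl: "ideal (Q i) (R Quot I)" if "i \<le> l" for i
    using Q[OF that] by (rule primeideal.axioms)
  have sub: "Q i \<subseteq> carrier (R Quot I)" if "i \<le> l" for i
    using additive_subgroup.a_subset[OF ideal.axioms(1)[OF idl[OF that]]] .
  have mem: "\<Union>(Q i) = {r \<in> carrier R. I +> r \<in> Q i}" if "i \<le> l" for i
    using canonical_proj_vimage_in_carrier[OF I sub[OF that]]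
      canonical_proj_vimage_mem_iff[OF I sub[OF that]] by blast
  (* The correspondence gives injectivity: a prime of the quotient is recovered from its union. *)
  have image_Union: "(+>) I ` \<Union>(Q i) = Q i" if "i \<le> l" for i
  proof -
    have "Q i \<in> (\<lambda>J. (+>) I ` J) ` {J. ideal J R \<and> I \<subseteq> J}"
      using quot_ideal_correspondence[OF I] idl[OF that] by (auto simp: bij_betw_def)
    then obtain J where "ideal J R" "I \<subseteq> J" "Q i = (+>) I ` J" by auto
    moreover have "\<Union>((+>) I ` J) = J"
      using ideal_incl_iff[OF I \<open>ideal J R\<close>] \<open>I \<subseteq> J\<close> by auto
    ultimately show ?thesis by simp
  qed
  show ?rhs
  proof (intro exI[of _ "\<lambda>i. \<Union>(Q i)"] conjI allI impI)
    fix i assume i: "i \<le> l"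
    show "primeideal (\<Union>(Q i)) R"
      unfolding mem[OF i] by (rule proj.primeideal_vimage[OF is_cring Q[OF i]])
    have "I \<in> Q i"
      using additive_subgroup.zero_closed[OF ideal.axioms(1)[OF idl[OF i]]]
      unfolding FactRing_def by simp
    then show "I \<subseteq> \<Union>(Q i)" by blast
  next
    fix i assume i: "i < l"
    then have "\<Union>(Q i) \<noteq> \<Union>(Q (Suc i))"
      using image_Union[of i] image_Union[of "Suc i"] chain[OF i] by (metis Suc_leI less_imp_le psubset_eq)
    moreover have "\<Union>(Q i) \<subseteq> \<Union>(Q (Suc i))" using chain[OF i] by blast
    ultimately show "\<Union>(Q i) \<subset> \<Union>(Q (Suc i))" by blast
  qed
next
  assume ?rhs
  then obtain P where P: "\<And>i. i \<le> l \<Longrightarrow> primeideal (P i) R" "\<And>i. i \<le> l \<Longrightarrow> I \<subseteq> P i"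
    and chain: "\<And>i. i < l \<Longrightarrow> P i \<subset> P (Suc i)" by blast
  have idl: "ideal (P i) R" if "i \<le> l" for i
    using P(1)[OF that] by (rule primeideal.axioms)
  have un: "\<Union>((+>) I ` P i) = P i" if "i \<le> l" for i
    using ideal_incl_iff[OF I idl[OF that]] P(2)[OF that] by auto
  have qidl: "ideal ((+>) I ` P i) (R Quot I)" if "i \<le> l" for i
    by (rule ring_ideal_imp_quot_ideal[OF I idl[OF that]])
  have mem: "I +> r \<in> (+>) I ` P i \<longleftrightarrow> r \<in> P i" if "i \<le> l" "r \<in> carrier R" for i r
    using canonical_proj_vimage_mem_iff[OF I _ that(2), of "(+>) I ` P i"] un[OF that(1)]
      additive_subgroup.a_subset[OF ideal.axioms(1)[OF qidl[OF that(1)]]] by auto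
  have carr: "carrier (R Quot I) = (+>) I ` carrier R"
    unfolding FactRing_def by (auto simp: A_RCOSETS_def')
  have prime: "primeideal ((+>) I ` P i) (R Quot I)" if i: "i \<le> l" for i
  proof (rule primeidealI[OF qidl[OF i] ideal.quotient_is_cring[OF I is_cring]])
    show "carrier (R Quot I) \<noteq> (+>) I ` P i"
      using mem[OF i one_closed] one_in_prime_ideal[OF P(1)[OF i]] by (auto simp: carr)
  next
    fix a b
    assume "a \<in> carrier (R Quot I)" "b \<in> carrier (R Quot I)"
      and ab: "a \<otimes>\<^bsub>R Quot I\<^esub> b \<in> (+>) I ` P i"
    then obtain r s where r: "r \<in> carrier R" "a = I +> r" and s: "s \<in> carrier R" "b = I +> s"
      by (auto simp: carr)
    have "a \<otimes>\<^bsub>R Quot I\<^esub> b = I +> (r \<otimes> s)"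
      using r s ideal.rcoset_mult_add[OF I r(1) s(1)] by (simp add: FactRing_def)
    then have "r \<otimes> s \<in> P i" using ab mem[OF i, of "r \<otimes> s"] r s by simp
    then show "a \<in> (+>) I ` P i \<or> b \<in> (+>) I ` P i"
      using primeideal.I_prime[OF P(1)[OF i] r(1) s(1)] r s by blast
  qed
  show ?lhs
  proof (intro exI[of _ "\<lambda>i. (+>) I ` P i"] conjI allI impI prime)
    fix i assume i: "i < l"
    then have "(+>) I ` P i \<noteq> (+>) I ` P (Suc i)"
      using un[of i] un[of "Suc i"] chain[OF i] by (metis Suc_leI less_imp_le psubset_eq)
    then show "(+>) I ` P i \<subset> (+>) I ` P (Suc i)" using chain[OF i] by blast
  qed
qed

lemma ideal_polynomial_ringD:
  assumes "ideal P (polynomial_ring V :: ('v, 'k::comm_ring_1) mpolynomial ring)"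
  shows "p \<in> P \<Longrightarrow> p \<in> polys_in V"
    and "0 \<in> P"
    and "p \<in> P \<Longrightarrow> q \<in> P \<Longrightarrow> p + q \<in> P"
    and "p \<in> P \<Longrightarrow> q \<in> P \<Longrightarrow> p - q \<in> P"
    and "p \<in> P \<Longrightarrow> q \<in> polys_in V \<Longrightarrow> q * p \<in> P"
proof -
  interpret ideal P "polynomial_ring V" by fact
  show "p \<in> polys_in V" if "p \<in> P" using a_Hcarr[OF that] by simp
  show "0 \<in> P" using additive_subgroup.zero_closed[OF ideal.axioms(1)[OF assms]] by simp
  show add: "p + q \<in> P" if "p \<in> P" "q \<in> P" for p q using additive_subgroup.a_closed[OF ideal.axioms(1)[OF assms] that] by simp
  show mult: "q * p \<in> P" if "p \<in> P" "q \<in> polys_in V" for p q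
    using I_l_closed[OF that(1), of q] that(2) by simp
  have "(-1) * q \<in> P" if "q \<in> P" for q
    by (rule mult[OF that supported_uminus[OF polys_in_one]])
  then show "p - q \<in> P" if "p \<in> P" "q \<in> P" using add[of p "(-1) * q"] that by simp
qed

lemma primeideal_polynomial_ringD:
  assumes "primeideal P (polynomial_ring V :: ('v, 'k::comm_ring_1) mpolynomial ring)"
  shows "ideal P (polynomial_ring V)" and "1 \<notin> P"
    and "p * q \<in> P \<Longrightarrow> p \<in> polys_in V \<Longrightarrow> q \<in> polys_in V \<Longrightarrow> p \<in> P \<or> q \<in> P"
  using assms one_in_prime_ideal[OF assms] primeideal.I_prime[OF assms]
  by (auto dest: primeideal.axioms)

section \<open>The length of a chain of primes\<close>

text \<open>
  The lattice points of a cube: the exponents with support in \<open>W\<close> and all entries at most \<open>d\<close>.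
  Bounding each exponent separately, instead of the total degree, makes both the count of
  monomials and the behaviour under products immediate.
\<close>

definition box :: "'v set \<Rightarrow> nat \<Rightarrow> ('v \<Rightarrow>\<^sub>0 nat) set" where
  "box W d = {m. keys m \<subseteq> W \<and> (\<forall>u. lookup m u \<le> d)}"

text \<open>
  A monomial in the box is determined by its values on \<open>W\<close>.
\<close>

lemma finite_card_box:
  assumes "finite W"
  shows "finite (box W d)" "card (box W d) \<le> Suc d ^ card W"
proof -
  let ?r = "\<lambda>m. restrict (lookup m) W"
  have inj: "inj_on ?r (box W d)"
  proof (rule inj_onI, rule poly_mapping_eqI)
    fix m m' u assume *: "m \<in> box W d" "m' \<in> box W d" "?r m = ?r m'"
    show "lookup m u = lookup m' u"
    proof (cases "u \<in> W")
      case True then show ?thesis using fun_cong[OF *(3), of u] by simp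
    next
      case False
      then have "u \<notin> keys m" "u \<notin> keys m'"
        using * by (auto simp: box_def)
      then show ?thesis by (simp add: in_keys_iff)
    qed
  qed
  have img: "?r ` box W d \<subseteq> W \<rightarrow>\<^sub>E {..d}" by (auto simp: box_def)
  have fin: "finite (W \<rightarrow>\<^sub>E {..d})" using assms by (simp add: finite_PiE)
  show "finite (box W d)" using inj img fin by (meson finite_imageD finite_subset)
  have "card (box W d) = card (?r ` box W d)" using inj by (simp add: card_image)
  also have "\<dots> \<le> card (W \<rightarrow>\<^sub>E {..d})" using img fin by (simp add: card_mono)
  also have "\<dots> = Suc d ^ card W" using assms by (simp add: card_PiE)
  finally show "card (box W d) \<le> Suc d ^ card W" .
qed

lemma box_mono:
  assumes "d \<le> e" shows "supported (box W d) \<subseteq> supported (box W e)"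
proof (rule supported_mono, rule subsetI)
  fix m assume m: "m \<in> box W d"
  then have "lookup m u \<le> e" for u
    using assms le_trans[of "lookup m u" d e] by (simp add: box_def)
  then show "m \<in> box W e" using m by (simp add: box_def)
qed

lemma box_mult:
  assumes "p \<in> supported (box W d)" "q \<in> supported (box W e)"
  shows "p * q \<in> supported (box W (d + e))"
  by (rule supported_mult[OF assms]) (auto simp: box_def keys_add_nat lookup_add add_mono)

lemma box_one: "1 \<in> supported (box W d)"
  by (auto simp: supported_def box_def)

lemma box_power: "p \<in> supported (box W d) \<Longrightarrow> p ^ e \<in> supported (box W (e * d))"
  by (induction e) (auto simp: box_one intro: box_mult)

lemma box_prod:
  "(\<And>i. i < l \<Longrightarrow> p i \<in> supported (box W d)) \<Longrightarrow> (\<Prod>i<l. p i) \<in> supported (box W (l * d))"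
proof (induction l)
  case (Suc l)
  then show ?case using box_mult[of "\<Prod>i<l. p i" W "l * d" "p l" d] by (simp add: add.commute)
qed (simp add: box_one)

lemma common_box:
  assumes "finite A" "\<And>i. i \<in> A \<Longrightarrow> p i \<in> polys_in W"
  obtains d where "\<And>i. i \<in> A \<Longrightarrow> p i \<in> supported (box W d)"
proof -
  define E where "E = (\<Union>i\<in>A. \<Union>m\<in>keys (p i). lookup m ` keys m)"
  have "finite E" unfolding E_def using assms(1) by simp
  then obtain d where d: "\<forall>e\<in>E. e \<le> d" by (auto simp: finite_nat_set_iff_bounded_le)
  have "lookup m u \<le> d" if "i \<in> A" "m \<in> keys (p i)" for i m u
  proof (cases "u \<in> keys m")
    case True then show ?thesis using that d unfolding E_def by blast
  qed (simp add: in_keys_iff)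
  then have "p i \<in> supported (box W d)" if "i \<in> A" for i
    using assms(2)[OF that] that by (auto simp: supported_def monomials_in_def box_def)
  then show thesis by (rule that)
qed

text \<open>
  Linear algebra over \<open>k\<close>: more polynomials than available monomials are linearly dependent.
  The family is indexed rather than a set, so a repetition counts as a relation as well.
\<close>

lemma nontrivial_relation:
  fixes g :: "'i \<Rightarrow> ('v, 'k::field) mpolynomial"
  assumes "finite A" "finite T" "\<And>a. a \<in> A \<Longrightarrow> g a \<in> supported T" "card T < card A"
  obtains c where "\<exists>a\<in>A. c a \<noteq> 0" "(\<Sum>a\<in>A. single 0 (c a) * g a) = 0"
proof (cases "inj_on g A")
  case False
  then obtain a b where ab: "a \<in> A" "b \<in> A" "a \<noteq> b" "g a = g b" by (auto simp: inj_on_def)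
  let ?c = "(\<lambda>_. 0 :: 'k)(a := 1, b := -1)"
  have "(\<Sum>x\<in>A. single 0 (?c x) * g x)
      = (\<Sum>x\<in>{a, b}. single 0 (?c x) * g x)"
    using ab assms(1) by (intro sum.mono_neutral_right) auto
  also have "\<dots> = 0" using ab by (simp add: Poly_Mapping.single_uminus)
  finally show thesis
    by (intro that[of ?c] bexI[of _ a]) (use ab in auto)
next
  case True
  interpret vs: vector_space "\<lambda>(c::'k) (p :: ('v, 'k) mpolynomial). single 0 c * p"
    by standard (simp_all add: distrib_left distrib_right Poly_Mapping.single_add mult_single
        flip: mult.assoc)
  have span: "g ` A \<subseteq> vs.span ((\<lambda>m. single m 1) ` T)"
  proof
    fix p assume "p \<in> g ` A"
    then have T: "keys p \<subseteq> T" using assms(3) by (auto simp: supported_def)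
    have "single m (lookup p m)
        \<in> vs.span ((\<lambda>m. single m 1) ` T)" if "m \<in> keys p" for m
    proof -
      have "single m (lookup p m)
          = single 0 (lookup p m) * single m 1"
        by (simp add: mult_single)
      then show ?thesis using that T by (auto intro: vs.span_scale vs.span_base)
    qed
    then have "(\<Sum>m\<in>keys p. single m (lookup p m))
        \<in> vs.span ((\<lambda>m. single m 1) ` T)" by (rule vs.span_sum)
    then show "p \<in> vs.span ((\<lambda>m. single m 1) ` T)"
      using mpolynomial_eq_sum_monomials[of p] by simp
  qed
  have "card ((\<lambda>m. single m (1::'k)) ` T) < card (g ` A)"
    using assms(2,4) True using card_image_le[OF assms(2), of "\<lambda>m. single m (1::'k)"] by (simp add: card_image)
  then have "vs.dependent (g ` A)"
    using vs.independent_span_bound[OF _ _ span] assms(2) by fastforce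
  then obtain u where u: "\<exists>v\<in>g ` A. u v \<noteq> 0"
      "(\<Sum>v\<in>g ` A. single 0 (u v) * v) = 0"
    unfolding vs.dependent_finite[OF finite_imageI[OF assms(1)]] by blast
  show thesis
    by (rule that[of "u \<circ> g"]) (use u True in \<open>auto simp: sum.reindex\<close>)
qed

text \<open>
  The cancellation step behind algebraic independence. The constant coefficient \<open>G\<^sub>0\<close> differs from
  an element of \<open>P\<close> by a multiple of \<open>f\<close>, so it lies in \<open>Q\<close> and hence vanishes by hypothesis. What
  is left is divisible by \<open>f\<close>, and since \<open>f\<close> is not in the prime \<open>P\<close>, one power of \<open>f\<close> cancels.
\<close>

lemma power_combination_vanishes:
  fixes G :: "nat \<Rightarrow> ('v, 'k::comm_ring_1) mpolynomial"
  assumes P: "primeideal P (polynomial_ring V)" and Q: "ideal Q (polynomial_ring V)"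
    and PQ: "P \<subseteq> Q" and f: "f \<in> Q" "f \<notin> P"
    and G: "\<And>j. j < N \<Longrightarrow> G j \<in> polys_in V"
      "\<And>j. j < N \<Longrightarrow> G j \<in> Q \<Longrightarrow> G j = 0"
    and "(\<Sum>j<N. f ^ j * G j) \<in> P" and "j < N"
  shows "G j = 0"
  using assms(6-)
proof (induction N arbitrary: G j)
  case (Suc N)
  note I = ideal_polynomial_ringD[OF Q] and D = primeideal_polynomial_ringD[OF P]
  let ?H = "\<Sum>j<N. f ^ j * G (Suc j)"
  have f_carr: "f \<in> polys_in V" using I(1)[OF f(1)] .
  have H: "?H \<in> polys_in V"
    using Suc.prems(1) by (intro supported_sum polys_in_mult polys_in_power f_carr) simp
  have sum: "G 0 + f * ?H \<in> P"
    using Suc.prems(3) by (simp add: sum.lessThan_Suc_shift sum_distrib_left mult.assoc del: sum.lessThan_Suc)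
  have "?H * f \<in> Q" by (rule I(5)[OF f(1) H])
  then have "G 0 \<in> Q" using I(4)[of "G 0 + f * ?H" "f * ?H"] sum PQ by (auto simp: mult.commute)
  then have G0: "G 0 = 0" using Suc.prems(2) by simp
  then have "?H \<in> P"
    using sum D(3)[of f ?H] f(2) f_carr H by simp
  moreover have "G (Suc j) \<in> polys_in V" "G (Suc j) \<in> Q \<Longrightarrow> G (Suc j) = 0" if "j < N" for j
    using Suc.prems(1,2)[of "Suc j"] that by simp_all
  ultimately have "G (Suc j) = 0" if "j < N" for j
    using Suc.IH[of "\<lambda>j. G (Suc j)" j] that by blast
  then show ?case using G0 Suc.prems(4) by (cases j) auto
qed simp

text \<open>
  Elements picked from the successive differences of a chain of primes are algebraically
  independent modulo the smallest one. A list \<open>es\<close> records the exponents of a product of powers, so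
  that splitting off its head expands a polynomial in \<open>f 0\<close> whose coefficients are polynomials in
  the other elements; those belong to the shortened chain starting at \<open>P 1\<close>, to which the induction
  hypothesis applies.
\<close>

lemma chain_elements_independent:
  fixes f :: "nat \<Rightarrow> ('v, 'k::field) mpolynomial" and c :: "nat list \<Rightarrow> 'k"
  assumes "\<And>i. i \<le> l \<Longrightarrow> primeideal (P i) (polynomial_ring V)"
    and "\<And>i. i < l \<Longrightarrow> P i \<subseteq> P (Suc i)"
    and "\<And>i. i < l \<Longrightarrow> f i \<in> P (Suc i) - P i"
    and "(\<Sum>es | set es \<subseteq> {..<N} \<and> length es = l.
           single 0 (c es) * (\<Prod>i<l. f i ^ (es ! i))) \<in> P 0"
    and "set es \<subseteq> {..<N}" "length es = l"
  shows "c es = 0"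
  using assms
proof (induction l arbitrary: P f c es)
  case 0
  have *: "{es. set es \<subseteq> {..<N} \<and> length es = 0} = {[]}" by auto
  have const: "single 0 (c []) \<in> P 0" using 0(4) unfolding * by simp
  note I = primeideal_polynomial_ringD[OF 0(1)[OF order_refl]]
  show ?case
  proof (rule ccontr)
    assume "c es \<noteq> 0"
    then have "single 0 (inverse (c [])) * single 0 (c []) = (1 :: ('v, 'k) mpolynomial)"
      using 0 by (simp add: mult_single)
    moreover have "single 0 (inverse (c [])) * single 0 (c []) \<in> P 0"
      by (rule ideal_polynomial_ringD(5)[OF I(1) const polys_in_const])
    ultimately show False using I(2) by simp
  qed
next
  case (Suc l)
  let ?E = "{es. set es \<subseteq> {..<N} \<and> length es = l}"
  define G where "G j = (\<Sum>es\<in>?E. single 0 (c (j # es)) * (\<Prod>i<l. f (Suc i) ^ (es ! i)))" for j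
  have E: "{es. set es \<subseteq> {..<N} \<and> length es = Suc l} = (\<lambda>(j, es). j # es) ` ({..<N} \<times> ?E)"
    by (auto simp: length_Suc_conv image_iff)
  have "(\<Sum>es | set es \<subseteq> {..<N} \<and> length es = Suc l.
           single 0 (c es) * (\<Prod>i<Suc l. f i ^ (es ! i)))
      = (\<Sum>(j, es)\<in>{..<N} \<times> ?E. single 0 (c (j # es)) * (f 0 ^ j * (\<Prod>i<l. f (Suc i) ^ (es ! i))))"
    unfolding E by (subst sum.reindex)
      (auto simp: inj_on_def prod.lessThan_Suc_shift simp del: prod.lessThan_Suc intro!: sum.cong)
  also have "\<dots> = (\<Sum>j<N. f 0 ^ j * G j)"
    by (simp add: sum.cartesian_product[symmetric] G_def sum_distrib_left mult_ac)
  finally have sum: "(\<Sum>j<N. f 0 ^ j * G j) \<in> P 0" using Suc.prems(4) by simp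
  (* The coefficients of G j are a relation for the chain P 1, ..., P (l+1). *)
  have vanish: "c (j # es) = 0" if "G j \<in> P (Suc 0)" "set es \<subseteq> {..<N}" "length es = l" for j es
    using Suc.IH[of "\<lambda>i. P (Suc i)" "\<lambda>i. f (Suc i)" "\<lambda>es. c (j # es)" es] Suc.prems(1-3) that
    by (simp add: G_def)
  have f: "f i \<in> polys_in V" if "i < Suc l" for i
    using that Suc.prems(3)[of i] primeideal_polynomial_ringD(1)[OF Suc.prems(1)[of "Suc i"]]
      ideal_polynomial_ringD(1) by auto
  have carr: "G j \<in> polys_in V" for j
    unfolding G_def by (intro supported_sum polys_in_mult polys_in_const polys_in_prod polys_in_power f) simp
  have "G j = 0" if "j < N" for j
  proof (rule power_combination_vanishes[OF _ _ _ _ _ carr _ sum that])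
    show "primeideal (P 0) (polynomial_ring V)" "ideal (P (Suc 0)) (polynomial_ring V)"
      using Suc.prems(1)[of 0] primeideal_polynomial_ringD(1)[OF Suc.prems(1)[of "Suc 0"]] by auto
    show "P 0 \<subseteq> P (Suc 0)" "f 0 \<in> P (Suc 0)" "f 0 \<notin> P 0"
      using Suc.prems(2)[of 0] Suc.prems(3)[of 0] by auto
    fix j assume "G j \<in> P (Suc 0)"
    then show "G j = 0" using vanish by (simp add: G_def)
  qed
  moreover have "0 \<in> P (Suc 0)"
    using ideal_polynomial_ringD(2) primeideal_polynomial_ringD(1)[OF Suc.prems(1)[of "Suc 0"]] by auto
  ultimately show ?case using vanish Suc.prems(5,6) by (cases es) auto
qed

text \<open>
  Each term is a multiple of one of its variables that lies in the ideal.
\<close>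

lemma mem_ideal_if_monomials_mem:
  fixes p :: "('v, 'k::comm_ring_1) mpolynomial"
  assumes P: "ideal P (polynomial_ring V)" and p: "p \<in> polys_in V"
    and var: "\<And>m. m \<in> keys p \<Longrightarrow> \<exists>u\<in>keys m. indet u \<in> P"
  shows "p \<in> P"
proof -
  note I = ideal_polynomial_ringD[OF P]
  have monomial: "single m (lookup p m) \<in> P" if m: "m \<in> keys p" for m
  proof -
    obtain u where u: "u \<in> keys m" "indet u \<in> P" using var[OF m] by blast
    have *: "m - single u 1 + single u 1 = m"
      using u(1) by (intro poly_mapping_eqI) (auto simp: lookup_add lookup_minus lookup_single when_def in_keys_iff)
    have "single (m - single u 1) (lookup p m) * indet u = single m (lookup p m)"
      unfolding indet_def mult_single * by simp
    moreover have "keys (m - single u 1) \<subseteq> keys m"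
      by (auto simp: in_keys_iff lookup_minus)
    then have "single (m - single u 1) (lookup p m) \<in> polys_in V"
      using p m by (intro supported_single) (auto simp: supported_def monomials_in_def)
    ultimately show ?thesis using I(5)[OF u(2)] by metis
  qed
  have sum: "(\<Sum>m\<in>A. single m (lookup p m)) \<in> P"
    if "finite A" "\<And>m. m \<in> A \<Longrightarrow> single m (lookup p m) \<in> P" for A
    using that by (induction A rule: finite_induct) (simp_all add: I(2,3))
  have "(\<Sum>m\<in>keys p. single m (lookup p m)) \<in> P"
    by (rule sum[OF finite_keys monomial])
  then show ?thesis using mpolynomial_eq_sum_monomials[of p] by simp
qed

lemma prime_contains_variable:
  assumes P: "primeideal P (polynomial_ring V :: ('v, 'k::comm_ring_1) mpolynomial ring)"
    and "finite A" "A \<subseteq> V" "(\<Prod>u\<in>A. indet u) \<in> P"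
  shows "\<exists>u\<in>A. indet u \<in> P"
  using assms(2-)
proof (induction A rule: finite_induct)
  case empty
  then show ?case using primeideal_polynomial_ringD(2)[OF P] by simp
next
  case (insert u A)
  have "indet u \<in> P \<or> (\<Prod>u\<in>A. indet u) \<in> P"
    using insert.prems insert.hyps
    by (intro primeideal_polynomial_ringD(3)[OF P] polys_in_prod polys_in_indet) auto
  then show ?case using insert by auto
qed

text \<open>
  The growth comparison: \<open>N\<^sup>l\<close> products of powers against \<open>O(N\<^sup>w)\<close> monomials. The base on the left is
  at most \<open>N\<close> times the constant \<open>l d + 1\<close>, so any \<open>N\<close> above the \<open>w\<close>-th power of that constant
  works.
\<close>

lemma box_eventually_smaller:
  assumes "(w::nat) < l"
  shows "\<exists>N. Suc (l * (N * d)) ^ w < N ^ l"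
proof -
  define C where "C = Suc (l * d) ^ w"
  define N where "N = Suc C"
  have "Suc (l * (N * d)) \<le> N * Suc (l * d)" by (simp add: N_def algebra_simps)
  then have "Suc (l * (N * d)) ^ w \<le> (N * Suc (l * d)) ^ w" by (rule power_mono) simp
  also have "\<dots> = N ^ w * C" unfolding C_def by (rule power_mult_distrib)
  also have "\<dots> < N ^ w * N" by (simp add: N_def)
  also have "\<dots> = N ^ Suc w" by simp
  also have "\<dots> \<le> N ^ l" using assms by (intro power_increasing) (simp_all add: N_def)
  finally show ?thesis by blast
qed

text \<open>
  A chain of primes is no longer than the number of variables that its smallest member leaves
  out. Were it longer, there would be too many independent products of powers for the monomials
  available to express them.
\<close>

lemma prime_chain_length_le:
  fixes P :: "nat \<Rightarrow> ('v, 'k::field) mpolynomial set"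
  assumes prime: "\<And>i. i \<le> l \<Longrightarrow> primeideal (P i) (polynomial_ring V)"
    and chain: "\<And>i. i < l \<Longrightarrow> P i \<subset> P (Suc i)"
    and W: "finite W" and vars: "\<And>u. u \<in> V - W \<Longrightarrow> indet u \<in> P 0"
  shows "l \<le> card W"
proof (rule ccontr)
  assume "\<not> l \<le> card W"
  have idl: "ideal (P i) (polynomial_ring V)" if "i \<le> l" for i
    by (rule primeideal_polynomial_ringD(1)[OF prime[OF that]])
  have P0: "P 0 \<subseteq> P i" if "i \<le> l" for i
    using that
  proof (induction i)
    case (Suc i)
    then show ?case using chain[of i] by auto
  qed simp
  (* Dropping the terms outside k[W] changes g by an element of P 0 only. *)
  have "\<exists>r. r \<in> P (Suc i) - P i \<and> r \<in> polys_in W" if i: "i < l" for i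
  proof -
    obtain g where g: "g \<in> P (Suc i)" "g \<notin> P i" using chain[OF i] by blast
    have gV: "g \<in> polys_in V" using ideal_polynomial_ringD(1)[OF idl g(1)] i by simp
    obtain r s where rs: "g = r + s" "keys r \<subseteq> keys g \<inter> monomials_in W" "keys s \<subseteq> keys g - monomials_in W"
      by (rule split_by_monomials)
    have "s \<in> P 0"
    proof (rule mem_ideal_if_monomials_mem[OF idl])
      show "s \<in> polys_in V" using rs(3) gV by (auto simp: supported_def)
      fix m assume "m \<in> keys s"
      then have "m \<in> monomials_in V" "m \<notin> monomials_in W"
        using rs(3) gV by (auto simp: supported_def)
      then show "\<exists>u\<in>keys m. indet u \<in> P 0" using vars by (auto simp: monomials_in_def)
    qed simp
    then have s: "s \<in> P i" "s \<in> P (Suc i)" using P0[of i] P0[of "Suc i"] i by auto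
    have "r = g - s" using rs(1) by simp
    then have "r \<in> P (Suc i)" using ideal_polynomial_ringD(4)[OF idl g(1) s(2)] i by simp
    moreover have "r \<notin> P i"
      using ideal_polynomial_ringD(3)[OF idl, of i r s] s(1) g(2) rs(1) i by auto
    moreover have "r \<in> polys_in W" using rs(2) by (auto simp: supported_def)
    ultimately show ?thesis by blast
  qed
  then obtain f where f: "\<And>i. i < l \<Longrightarrow> f i \<in> P (Suc i) - P i"
    and fW: "\<And>i. i < l \<Longrightarrow> f i \<in> polys_in W" by metis
  obtain d where d: "\<And>i. i \<in> {..<l} \<Longrightarrow> f i \<in> supported (box W d)"
    by (rule common_box[of "{..<l}" f W]) (use fW in auto)
  obtain N where N: "Suc (l * (N * d)) ^ card W < N ^ l"
    using box_eventually_smaller \<open>\<not> l \<le> card W\<close> not_le by blast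
  let ?E = "{es. set es \<subseteq> {..<N} \<and> length es = l}"
  (* d bounds the exponents in every f i, so a product of powers below N stays in a box of size l N d. *)
  let ?g = "\<lambda>es. \<Prod>i<l. f i ^ (es ! i)"
  have E: "finite ?E" "card ?E = N ^ l"
    using finite_lists_length_eq[of "{..<N}" l] card_lists_length_eq[of "{..<N}" l] by simp_all
  have g: "?g es \<in> supported (box W (l * (N * d)))" if "es \<in> ?E" for es
  proof (rule box_prod)
    fix i assume "i < l"
    then have "es ! i \<le> N" using that nth_mem[of i es] by fastforce
    then show "f i ^ (es ! i) \<in> supported (box W (N * d))"
      using box_power[OF d[of i]] box_mono[of "es ! i * d" "N * d" W] \<open>i < l\<close> by auto
  qed
  have less: "card (box W (l * (N * d))) < card ?E"
    using finite_card_box(2)[OF W, of "l * (N * d)"] N E(2) by simp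
  obtain c where c: "\<exists>es\<in>?E. c es \<noteq> 0" "(\<Sum>es\<in>?E. single 0 (c es) * ?g es) = 0"
    by (rule nontrivial_relation[where g = ?g, OF E(1) finite_card_box(1)[OF W] g less])
  have "c es = 0" if "es \<in> ?E" for es
  proof (rule chain_elements_independent[where P = P and f = f and l = l and N = N and c = c])
    show "(\<Sum>es\<in>?E. single 0 (c es) * ?g es) \<in> P 0"
      using c(2) ideal_polynomial_ringD(2)[OF idl[of 0]] by simp
    show "P i \<subseteq> P (Suc i)" if "i < l" for i using chain[OF that] by blast
    show "set es \<subseteq> {..<N}" "length es = l" using that by simp_all
  qed (fact prime f)+
  then show False using c(1) by blast
qed

section \<open>The dimension of a squarefree monomial quotient\<close>

text \<open>
  The ideal of \<open>k[V]\<close> generated by the variables in \<open>S\<close>, described by its members: the polynomials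
  all of whose terms involve a variable of \<open>S\<close>.
\<close>

definition monomial_prime :: "'v set \<Rightarrow> 'v set \<Rightarrow> ('v, 'k::comm_ring_1) mpolynomial set" where
  "monomial_prime V S = supported {m. keys m \<subseteq> V \<and> keys m \<inter> S \<noteq> {}}"

lemma indet_mem_monomial_prime_iff:
  "u \<in> V \<Longrightarrow> (indet u :: ('v, 'k::comm_ring_1) mpolynomial) \<in> monomial_prime V S \<longleftrightarrow> u \<in> S"
  by (simp add: monomial_prime_def supported_def indet_def)

lemma monomial_prime_mono: "S \<subseteq> T \<Longrightarrow> monomial_prime V S \<subseteq> monomial_prime V T"
  unfolding monomial_prime_def by (rule supported_mono) auto

lemma monomial_prime_subset: "monomial_prime V S \<subseteq> polys_in V"
  unfolding monomial_prime_def by (rule supported_mono) (auto simp: monomials_in_def)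

lemma ideal_monomial_prime:
  "ideal (monomial_prime V S) (polynomial_ring V :: ('v, 'k::comm_ring_1) mpolynomial ring)"
proof -
  let ?R = "polynomial_ring V :: ('v, 'k) mpolynomial ring"
  let ?P = "monomial_prime V S :: ('v, 'k) mpolynomial set"
  interpret cring ?R by (rule cring_polynomial_ring)
  have mult: "q * p \<in> ?P" if "p \<in> ?P" "q \<in> polys_in V" for p q
    unfolding monomial_prime_def
    by (rule supported_mult[OF that(2) that(1)[unfolded monomial_prime_def]])
       (auto simp: monomials_in_def keys_add_nat)
  show ?thesis
  proof (rule idealI[OF ring_axioms])
    show "subgroup ?P (add_monoid ?R)"
    proof (rule add.subgroupI)
      show "?P \<subseteq> carrier ?R" using monomial_prime_subset by simp
      show "?P \<noteq> {}" using supported_zero by (auto simp: monomial_prime_def)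
    next
      fix p assume p: "p \<in> ?P"
      have "\<ominus>\<^bsub>?R\<^esub> p = - p"
        using p monomial_prime_subset by (intro minus_equality) (auto intro: supported_uminus)
      then show "\<ominus>\<^bsub>?R\<^esub> p \<in> ?P"
        using p by (simp add: monomial_prime_def supported_uminus)
    qed (simp add: monomial_prime_def supported_add)
  next
    fix p q assume pq: "p \<in> ?P" "q \<in> carrier ?R"
    show "q \<otimes>\<^bsub>?R\<^esub> p \<in> ?P" using mult pq by simp
    then show "p \<otimes>\<^bsub>?R\<^esub> q \<in> ?P" by (simp add: mult.commute)
  qed
qed

text \<open>
  The quotient is the polynomial ring in the remaining variables, an integral domain. Concretely,
  if \<open>r\<close> and \<open>r'\<close> are the parts of two factors that avoid \<open>S\<close>, then \<open>r r'\<close> also avoids \<open>S\<close>, while it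
  agrees with the full product modulo the ideal. The linear order on variables orders the monomials,
  and leading terms show that polynomials have no zero divisors.
\<close>

lemma primeideal_monomial_prime:
  "primeideal (monomial_prime V S) (polynomial_ring V :: ('v::linorder, 'k::field) mpolynomial ring)"
proof (rule primeidealI[OF ideal_monomial_prime cring_polynomial_ring])
  let ?R = "polynomial_ring V :: ('v, 'k) mpolynomial ring"
  let ?P = "monomial_prime V S :: ('v, 'k) mpolynomial set"
  let ?N = "{m. keys m \<inter> S = {}}"
  note I = ideal_polynomial_ringD[OF ideal_monomial_prime[of V S]]
  have "1 \<notin> ?P" by (simp add: monomial_prime_def supported_def)
  then show "carrier ?R \<noteq> ?P" using polys_in_one[of V] by auto
  fix p q assume "p \<in> carrier ?R" "q \<in> carrier ?R" and "p \<otimes>\<^bsub>?R\<^esub> q \<in> ?P"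
  then have p: "p \<in> polys_in V" and q: "q \<in> polys_in V" and pq: "p * q \<in> ?P" by simp_all
  have split: "\<exists>r s. g = r + s \<and> r \<in> supported ?N \<and> r \<in> polys_in V \<and> s \<in> ?P"
    if "g \<in> polys_in V" for g :: "('v, 'k) mpolynomial"
  proof -
    obtain r s where "g = r + s" "keys r \<subseteq> keys g \<inter> ?N" "keys s \<subseteq> keys g - ?N"
      by (rule split_by_monomials)
    moreover from this that have "r \<in> supported ?N" "r \<in> polys_in V" "s \<in> ?P"
      by (auto simp: supported_def monomials_in_def monomial_prime_def)
    ultimately show ?thesis by blast
  qed
  obtain r s where rs: "p = r + s" "r \<in> supported ?N" "r \<in> polys_in V" "s \<in> ?P"
    using split[OF p] by blast
  obtain r' s' where rs': "q = r' + s'" "r' \<in> supported ?N" "r' \<in> polys_in V" "s' \<in> ?P"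
    using split[OF q] by blast
  have "q * s + r * s' \<in> ?P"
    by (intro I(3) I(5) rs(4) rs'(4) q rs(3))
  moreover have "r * r' = p * q - (q * s + r * s')"
    by (simp add: rs(1) rs'(1) algebra_simps)
  ultimately have "r * r' \<in> ?P" using I(4)[OF pq] by simp
  moreover have "r * r' \<in> supported ?N"
    by (rule supported_mult[OF rs(2) rs'(2)]) (auto simp: keys_add_nat)
  ultimately have "keys (r * r') = {}" by (fastforce simp: monomial_prime_def supported_def)
  then have "r * r' = 0" by (intro poly_mapping_eqI) (auto simp: in_keys_iff)
  then show "p \<in> ?P \<or> q \<in> ?P" using rs rs' by auto
qed

text \<open>
  Every ideal generated by squarefree monomials has this form. When \<open>\<A>\<close> is the set of non-faces of a
  simplicial complex, it is the Stanley--Reisner ideal of that complex.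
\<close>

definition squarefree_ideal :: "'v set \<Rightarrow> 'v set set \<Rightarrow> ('v, 'k::comm_ring_1) mpolynomial set" where
  "squarefree_ideal V \<A> = genideal (polynomial_ring V) ((\<lambda>A. \<Prod>u\<in>A. indet u) ` \<A>)"

text \<open>
  The sets that contain no member of \<open>\<A>\<close> are the faces of the simplicial complex attached to the
  ideal, and the dimension of the quotient is the largest size of a face. A chain of primes produces
  the face of variables missing from its smallest member; a face \<open>W\<close> produces the chain that adjoins
  its variables one by one to those outside \<open>W\<close>.
\<close>

theorem krull_dim_squarefree_quotient:
  fixes V :: "'v::linorder set"
  assumes V: "finite V" and gens: "\<And>A. A \<in> \<A> \<Longrightarrow> A \<subseteq> V"
    and W: "W \<subseteq> V" "\<And>A. A \<in> \<A> \<Longrightarrow> \<not> A \<subseteq> W"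
    and max: "\<And>U. U \<subseteq> V \<Longrightarrow> (\<And>A. A \<in> \<A> \<Longrightarrow> \<not> A \<subseteq> U) \<Longrightarrow> card U \<le> card W"
  shows "krull_dim (polynomial_ring V Quot (squarefree_ideal V \<A> :: ('v, 'k::field) mpolynomial set))
    = enat (card W)"
proof -
  let ?R = "polynomial_ring V :: ('v, 'k) mpolynomial ring"
  let ?I = "squarefree_ideal V \<A> :: ('v, 'k) mpolynomial set"
  let ?gen = "\<lambda>A. \<Prod>u\<in>A. indet u :: ('v, 'k) mpolynomial"
  interpret cring ?R by (rule cring_polynomial_ring)
  have gens_carr: "?gen ` \<A> \<subseteq> carrier ?R"
    using gens by (auto intro!: polys_in_prod polys_in_indet)
  have I: "ideal ?I ?R" unfolding squarefree_ideal_def by (rule genideal_ideal[OF gens_carr])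
  have upper: "l \<le> card W"
    if prime: "\<forall>i\<le>l. primeideal (P i) ?R \<and> ?I \<subseteq> P i" and chain: "\<forall>i<l. P i \<subset> P (Suc i)" for l P
  proof -
    let ?U = "{u \<in> V. indet u \<notin> P 0}"
    have "\<not> A \<subseteq> ?U" if A: "A \<in> \<A>" for A
    proof -
      have "?gen A \<in> P 0"
        using genideal_self[OF gens_carr] prime A unfolding squarefree_ideal_def by blast
      then show ?thesis
        using prime_contains_variable[of "P 0" V A] prime gens[OF A] V finite_subset by blast
    qed
    then have "card ?U \<le> card W" by (intro max) auto
    moreover have "l \<le> card ?U"
      by (rule prime_chain_length_le[of l P V]) (use prime chain V in auto)
    ultimately show ?thesis by simp
  qed
  obtain h where h: "bij_betw h {..<card W} W"
    using ex_bij_betw_nat_finite[of W] W(1) V finite_subset by (metis atLeast0LessThan)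
  define P :: "nat \<Rightarrow> ('v, 'k) mpolynomial set" where "P i = monomial_prime V (V - W \<union> h ` {..<i})" for i
  have lower: "primeideal (P i) ?R \<and> ?I \<subseteq> P i" for i
  proof
    show "primeideal (P i) ?R" unfolding P_def by (rule primeideal_monomial_prime)
    have "?gen A \<in> P i" if A: "A \<in> \<A>" for A
    proof -
      obtain u where u: "u \<in> A" "u \<in> V - W" using W(2)[OF A] gens[OF A] by blast
      have "finite A" using gens[OF A] V finite_subset by blast
      then have "?gen A = ?gen (A - {u}) * indet u"
        using u(1) by (simp add: prod.remove mult.commute)
      also have "\<dots> \<in> P i"
        unfolding P_def
      proof (rule ideal_polynomial_ringD(5)[OF ideal_monomial_prime])
        show "indet u \<in> monomial_prime V (V - W \<union> h ` {..<i})"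
          using u by (simp add: indet_mem_monomial_prime_iff)
        show "?gen (A - {u}) \<in> polys_in V"
          using gens[OF A] by (intro polys_in_prod polys_in_indet) auto
      qed
      finally show ?thesis .
    qed
    then show "?I \<subseteq> P i"
      unfolding squarefree_ideal_def
      by (intro genideal_minimal) (auto simp: P_def ideal_monomial_prime)
  qed
  have chain: "P i \<subset> P (Suc i)" if i: "i < card W" for i
  proof -
    have "h i \<in> W" using h i by (auto simp: bij_betw_def)
    moreover have "h i \<notin> h ` {..<i}"
    proof
      assume "h i \<in> h ` {..<i}"
      then obtain k where "k < i" "h i = h k" by blast
      then show False using inj_onD[OF bij_betw_imp_inj_on[OF h], of i k] i by simp
    qed
    ultimately have "(indet (h i) :: ('v, 'k) mpolynomial) \<in> P (Suc i)" "(indet (h i) :: ('v, 'k) mpolynomial) \<notin> P i"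
      using W(1) by (auto simp: P_def indet_mem_monomial_prime_iff)
    moreover have "P i \<subseteq> P (Suc i)"
      unfolding P_def by (rule monomial_prime_mono) auto
    ultimately show ?thesis by blast
  qed
  show ?thesis
    unfolding krull_dim_def quot_prime_chain_iff[OF I]
  proof (rule antisym)
    show "(SUP l\<in>{l. \<exists>P. (\<forall>i\<le>l. primeideal (P i) ?R \<and> ?I \<subseteq> P i) \<and> (\<forall>i<l. P i \<subset> P (Suc i))}. enat l)
        \<le> enat (card W)"
      using upper by (intro SUP_least) auto
    show "enat (card W) \<le> (SUP l\<in>{l. \<exists>P. (\<forall>i\<le>l. primeideal (P i) ?R \<and> ?I \<subseteq> P i)
        \<and> (\<forall>i<l. P i \<subset> P (Suc i))}. enat l)"
      using lower chain by (intro SUP_upper) blast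
  qed
qed

section \<open>Matchings in fan graphs\<close>

text \<open>
  Pigeonhole: an edge contributes at most one chosen vertex, or two if it lies inside \<open>W\<close>. So
  a surplus of \<open>q\<close> vertices over \<open>m\<close> forces \<open>q\<close> edges inside \<open>W\<close>.
\<close>

lemma card_ge_imp_submatching:
  assumes M: "is_matching G m M" and two: "\<And>e. e \<in> M \<Longrightarrow> card e = 2"
    and W: "W \<subseteq> \<Union>M" "m + q \<le> card W"
  obtains M' where "is_matching G q M'" "\<Union>M' \<subseteq> W"
proof -
  have fin: "finite M" "card M = m" and disj: "pairwise disjnt M"
    using M by (auto simp: is_matching_def)
  have fin_e: "finite e" if "e \<in> M" for e using two[OF that] by (simp add: card_ge_0_finite)
  let ?F = "{e \<in> M. e \<subseteq> W}"
  have "W = (\<Union>e\<in>M. W \<inter> e)" using W(1) by blast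
  then have "card W = card (\<Union>e\<in>M. W \<inter> e)" by simp
  also have "\<dots> \<le> (\<Sum>e\<in>M. card (W \<inter> e))" by (rule card_UN_le[OF fin(1)])
  also have "\<dots> \<le> (\<Sum>e\<in>M. 1 + (if e \<subseteq> W then 1 else 0))"
  proof (rule sum_mono)
    fix e assume e: "e \<in> M"
    show "card (W \<inter> e) \<le> 1 + (if e \<subseteq> W then 1 else 0)"
    proof (cases "e \<subseteq> W")
      case True
      then show ?thesis using two[OF e] by (simp add: Int_absorb1)
    next
      case False
      then have "W \<inter> e \<subset> e" by blast
      then have "card (W \<inter> e) < card e" by (rule psubset_card_mono[OF fin_e[OF e]])
      then show ?thesis using two[OF e] by simp
    qed
  qed
  also have "\<dots> = m + card ?F"
  proof -
    have "M \<inter> {e. e \<subseteq> W} = ?F" by auto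
    then have "(\<Sum>e\<in>M. if e \<subseteq> W then 1 else 0 :: nat) = card ?F"
      using fin(1) by (simp add: sum.If_cases)
    then show ?thesis using fin(2) unfolding sum.distrib by simp
  qed
  finally have "q \<le> card ?F" using W(2) by simp
  then obtain M' where M': "M' \<subseteq> ?F" "card M' = q" "finite M'"
    by (rule obtain_subset_with_card_n)
  have "is_matching G q M'"
    using M M' pairwise_subset[OF disj, of M'] by (auto simp: is_matching_def)
  moreover have "\<Union>M' \<subseteq> W" using M'(1) by blast
  ultimately show thesis by (rule that)
qed

text \<open>
  Disjoint edges meet the cover in distinct vertices.
\<close>

lemma matching_card_le_vertex_cover:
  assumes "is_matching G m M" and "finite U" and "\<And>e. e \<in> M \<Longrightarrow> e \<inter> U \<noteq> {}"
  shows "m \<le> card U"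
proof -
  obtain f where f: "\<And>e. e \<in> M \<Longrightarrow> f e \<in> e \<inter> U" using bchoice[of M "\<lambda>e u. u \<in> e \<inter> U"] assms(3) by blast
  have "inj_on f M"
  proof (rule inj_onI, rule ccontr)
    fix e e' assume "e \<in> M" "e' \<in> M" "f e = f e'" "e \<noteq> e'"
    then show False
      using assms(1) f[of e] f[of e'] unfolding is_matching_def pairwise_def disjnt_def
      by (metis IntD1 disjoint_iff)
  qed
  then have "card M \<le> card U" using f assms(2) by (intro card_inj_on_le[of f]) auto
  then show ?thesis using assms(1) by (simp add: is_matching_def)
qed

lemma verts_fan_graph: "verts (fan_graph n) = insert Hub (Rim ` {1..n})"
  by (simp add: fan_graph_def)

lemma finite_verts_fan_graph: "finite (verts (fan_graph n))"
  by (simp add: verts_fan_graph)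

lemma card_verts_fan_graph: "card (verts (fan_graph n)) = Suc n"
  by (simp add: verts_fan_graph card_insert_if card_image inj_on_def image_iff)

lemma fan_edge_subset: "e \<in> edges (fan_graph n) \<Longrightarrow> e \<subseteq> verts (fan_graph n)"
  by (auto simp: fan_graph_def)

lemma card_fan_edge: "e \<in> edges (fan_graph n) \<Longrightarrow> card e = 2"
  by (auto simp: fan_graph_def)

text \<open>
  Numbering of fan vertices in which the hub takes over position \<open>j\<close> on the rim. The hub is adjacent to
  every rim vertex, so consecutive positions stay adjacent. Position \<open>0\<close> lies off the rim, so \<open>j = 0\<close>
  leaves the hub out, while \<open>j = n + 1\<close> appends it at the end of the path.
\<close>

definition fan_label :: "nat \<Rightarrow> nat \<Rightarrow> fan_vertex" where
  "fan_label j = Rim(j := Hub)"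

definition consecutive_pairs :: "nat \<Rightarrow> nat \<Rightarrow> fan_vertex set set" where
  "consecutive_pairs j h = (\<lambda>i. fan_label j ` {2 * i + 1, 2 * i + 2}) ` {..<h}"

lemma inj_fan_label: "inj (fan_label j)"
  by (auto simp: inj_def fan_label_def)

lemma Union_consecutive_pairs: "\<Union>(consecutive_pairs j h) = fan_label j ` {1..2 * h}"
proof -
  have "(\<Union>i<h. {2 * i + 1, 2 * i + 2}) = {1..2 * h}"
  proof (intro equalityI subsetI)
    fix k assume "k \<in> {1..2 * h}"
    then have "(k - 1) div 2 < h" "k \<in> {2 * ((k - 1) div 2) + 1, 2 * ((k - 1) div 2) + 2}" by auto
    then show "k \<in> (\<Union>i<h. {2 * i + 1, 2 * i + 2})" by blast
  qed auto
  then show ?thesis unfolding consecutive_pairs_def by (metis image_UN)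
qed

lemma is_matching_consecutive_pairs:
  assumes "{1..2 * h} - {j} \<subseteq> {1..n}"
  shows "is_matching (fan_graph n) h (consecutive_pairs j h)"
proof -
  let ?e = "\<lambda>i. fan_label j ` {2 * i + 1, 2 * i + 2}"
  have disj: "disjnt (?e i) (?e k)" if "i \<noteq> k" for i k
  proof -
    have "disjnt {2 * i + 1, 2 * i + 2} {2 * k + 1, 2 * k + 2}" using that by (auto simp: disjnt_def; presburger)
    then show ?thesis using inj_fan_label[of j]
      by (simp add: disjnt_def flip: image_Int del: image_insert)
  qed
  then have "inj_on ?e {..<h}"
    by (intro inj_onI) (metis disjnt_self_iff_empty image_is_empty insert_not_empty)
  then have card: "card (consecutive_pairs j h) = h"
    by (simp add: consecutive_pairs_def card_image del: image_insert)
  have "?e i \<in> edges (fan_graph n)" if "i < h" for i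
  proof -
    have bound: "k \<in> {1..n}" if "k \<in> {2 * i + 1, 2 * i + 2}" "k \<noteq> j" for k
      using assms that \<open>i < h\<close> by (auto simp: subset_iff)
    consider "j = 2 * i + 1" | "j = 2 * i + 2" | "j \<noteq> 2 * i + 1" "j \<noteq> 2 * i + 2" by blast
    then show ?thesis
    proof cases
      case 1
      then have "?e i = {Hub, Rim (2 * i + 2)}" by (auto simp: fan_label_def)
      then show ?thesis using bound[of "2 * i + 2"] 1 by (auto simp: fan_graph_def)
    next
      case 2
      then have "?e i = {Hub, Rim (2 * i + 1)}" by (auto simp: fan_label_def)
      then show ?thesis using bound[of "2 * i + 1"] 2 by (auto simp: fan_graph_def)
    next
      case 3
      then have "?e i = {Rim (2 * i + 1), Rim (2 * i + 1 + 1)}" by (simp add: fan_label_def)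
      then show ?thesis using bound[of "2 * i + 2"] 3 by (fastforce simp: fan_graph_def)
    qed
  qed
  then show ?thesis
    unfolding is_matching_def
  proof (intro conjI card)
    assume edges: "\<And>i. i < h \<Longrightarrow> ?e i \<in> edges (fan_graph n)"
    show "consecutive_pairs j h \<subseteq> edges (fan_graph n)"
      unfolding consecutive_pairs_def by (rule image_subsetI) (rule edges, simp)
    show "finite (consecutive_pairs j h)" by (simp add: consecutive_pairs_def)
    show "pairwise disjnt (consecutive_pairs j h)"
      unfolding consecutive_pairs_def by (rule pairwise_imageI) (rule disj)
  qed
qed

text \<open>
  For odd \<open>n\<close> the path \<open>x\<^sub>1, \<dots>, x\<^sub>n, v\<close> has an even number of vertices and its alternate edges cover
  the fan. For even \<open>n\<close> there is one vertex too many; when some \<open>x\<^sub>k\<close> is to be avoided, the hub steps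
  into its place in the matching \<open>x\<^sub>1x\<^sub>2, x\<^sub>3x\<^sub>4, \<dots>\<close> of the rim.
\<close>

lemma fan_near_perfect_matching:
  assumes "W \<subseteq> verts (fan_graph n)" and "odd n \<or> W \<noteq> verts (fan_graph n)"
  obtains M where "is_matching (fan_graph n) ((n + 1) div 2) M" "W \<subseteq> \<Union>M"
proof -
  let ?h = "(n + 1) div 2"
  obtain j where j: "{1..2 * ?h} - {j} \<subseteq> {1..n}" "W \<subseteq> fan_label j ` {1..2 * ?h}"
  proof (cases "odd n")
    case True
    then have h: "2 * ?h = n + 1" by presburger
    have "verts (fan_graph n) \<subseteq> fan_label (n + 1) ` {1..2 * ?h}"
      unfolding h by (auto simp: verts_fan_graph fan_label_def image_iff)
    moreover have "{1..2 * ?h} - {n + 1} \<subseteq> {1..n}" unfolding h by auto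
    ultimately show thesis using that[of "n + 1"] assms(1) by blast
  next
    case False
    then have h: "2 * ?h = n" by presburger
    obtain u where u: "u \<in> verts (fan_graph n)" "u \<notin> W" using assms False by blast
    show thesis
    proof (cases u)
      case Hub
      then have "W \<subseteq> fan_label 0 ` {1..n}"
        using u assms(1) by (fastforce simp: verts_fan_graph fan_label_def image_iff)
      then show thesis using that[of 0] h by auto
    next
      case (Rim k)
      then have "k \<in> {1..n}" using u by (auto simp: verts_fan_graph)
      moreover have "v \<in> fan_label k ` {1..n}" if "v \<in> W" for v
      proof (cases v)
        case Hub
        then show ?thesis using \<open>k \<in> {1..n}\<close> by (auto simp: fan_label_def image_iff)
      next
        case (Rim i)
        then have "i \<in> {1..n}" "i \<noteq> k" using that assms(1) u \<open>u = Rim k\<close> by (auto simp: verts_fan_graph)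
        then show ?thesis using Rim by (auto simp: fan_label_def image_iff)
      qed
      ultimately show thesis using that[of k] h by auto
    qed
  qed
  show thesis
    using that[OF is_matching_consecutive_pairs[OF j(1)]] j(2) by (simp add: Union_consecutive_pairs)
qed

text \<open>
  The bound on the size of a set without \<open>q\<close>-matchings. If \<open>n\<close> is even and the set is everything, one
  vertex must be given up before a near-perfect matching covers the rest; the \<open>n = 2h\<close> remaining
  vertices are still at least \<open>h + q\<close>, and this is where \<open>q \<le> h\<close> enters.
\<close>

lemma large_subset_contains_fan_matching:
  assumes W: "W \<subseteq> verts (fan_graph n)" and q: "q \<le> (n + 1) div 2"
    and card: "(n + 1) div 2 + q \<le> card W"
  obtains M where "is_matching (fan_graph n) q M" "\<Union>M \<subseteq> W"
proof -
  obtain W' where W': "W' \<subseteq> W" "(n + 1) div 2 + q \<le> card W'" "odd n \<or> W' \<noteq> verts (fan_graph n)"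
  proof (cases "odd n \<or> W \<noteq> verts (fan_graph n)")
    case True
    then show thesis using that[of W] card by simp
  next
    case False
    then have W_eq: "W = verts (fan_graph n)" by simp
    have "card (W - {Hub}) = n" "W - {Hub} \<noteq> verts (fan_graph n)"
      unfolding W_eq using card_verts_fan_graph[of n] card_Diff_singleton[of Hub "verts (fan_graph n)"]
      by (auto simp: verts_fan_graph simp del: insert_Diff_single insert_Diff1)
    then show thesis using that[of "W - {Hub}"] q False by auto
  qed
  obtain M where M: "is_matching (fan_graph n) ((n + 1) div 2) M" "W' \<subseteq> \<Union>M"
    by (rule fan_near_perfect_matching[of W' n]) (use W' W in auto)
  have "card e = 2" if "e \<in> M" for e
    using that M(1) card_fan_edge by (auto simp: is_matching_def)
  then obtain M' where "is_matching (fan_graph n) q M'" "\<Union>M' \<subseteq> W'"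
    using card_ge_imp_submatching[OF M(1) _ M(2) W'(2)] by metis
  then show thesis using that W'(1) by blast
qed

lemma fan_matching_size_le:
  assumes "is_matching (fan_graph n) q M"
  shows "q \<le> (n + 1) div 2"
proof -
  have M: "M \<subseteq> edges (fan_graph n)" "finite M" "card M = q" "pairwise disjnt M"
    using assms by (auto simp: is_matching_def)
  have "card (\<Union>M) = (\<Sum>e\<in>M. card e)"
    using M card_fan_edge by (intro card_Union_disjoint) (auto simp: card_ge_0_finite subset_iff)
  also have "\<dots> = (\<Sum>e\<in>M. 2)" using M(1) card_fan_edge by (intro sum.cong) auto
  finally have "2 * q = card (\<Union>M)" using M(3) by simp
  also have "\<dots> \<le> card (verts (fan_graph n))"
    using M(1) fan_edge_subset by (intro card_mono finite_verts_fan_graph) blast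
  finally show ?thesis by (simp add: card_verts_fan_graph)
qed

lemma matching_number_fan_graph: "matching_number (fan_graph n) = (n + 1) div 2"
  unfolding matching_number_def
proof (rule Max_eqI)
  show "finite {q. \<exists>M. is_matching (fan_graph n) q M}"
    by (rule finite_subset[of _ "{..(n + 1) div 2}"]) (auto dest: fan_matching_size_le)
  obtain M where "is_matching (fan_graph n) ((n + 1) div 2) M"
    by (rule fan_near_perfect_matching[of "{}" n]) (auto simp: verts_fan_graph)
  then show "(n + 1) div 2 \<in> {q. \<exists>M. is_matching (fan_graph n) q M}" by blast
qed (auto dest: fan_matching_size_le)

text \<open>
  The bound is attained: alternate rim vertices are independent, so the \<open>q - 1\<close> vertices added to
  them cover all edges inside the chosen set.
\<close>

lemma large_matching_free_subset:
  assumes q: "1 \<le> q" "q \<le> (n + 1) div 2"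
  obtains W where "W \<subseteq> verts (fan_graph n)" "card W = (n + 1) div 2 + q - 1"
    "\<And>M. is_matching (fan_graph n) q M \<Longrightarrow> \<not> \<Union>M \<subseteq> W"
proof -
  let ?h = "(n + 1) div 2" and ?V = "verts (fan_graph n)"
  define S where "S = (\<lambda>i. Rim (2 * i + 1)) ` {..<?h}"
  have S: "finite S" "S \<subseteq> ?V" "card S = ?h"
    by (auto simp: S_def verts_fan_graph card_image inj_on_def)
  have indep: "\<not> e \<subseteq> S" if e: "e \<in> edges (fan_graph n)" for e
  proof
    assume "e \<subseteq> S"
    moreover have "Hub \<notin> S" by (auto simp: S_def)
    moreover obtain i where "e = {Rim i, Rim (i + 1)} \<or> e = {Hub, Rim i}"
      using e by (auto simp: fan_graph_def)
    ultimately have "Rim i \<in> S" "Rim (i + 1) \<in> S" by auto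
    then show False by (auto simp: S_def) presburger
  qed
  have "q - 1 \<le> card (?V - S)"
    using S q by (simp add: card_Diff_subset card_verts_fan_graph)
  then obtain U where U: "U \<subseteq> ?V - S" "card U = q - 1" "finite U"
    by (rule obtain_subset_with_card_n)
  show thesis
  proof (rule that)
    show "S \<union> U \<subseteq> ?V" using S U by blast
    show "card (S \<union> U) = ?h + q - 1"
      using S U q card_Un_disjoint[of S U] by auto
    fix M assume M: "is_matching (fan_graph n) q M"
    show "\<not> \<Union>M \<subseteq> S \<union> U"
    proof
      assume sub: "\<Union>M \<subseteq> S \<union> U"
      have "e \<inter> U \<noteq> {}" if "e \<in> M" for e
        using that sub indep[of e] M by (auto simp: is_matching_def)
      then have "q \<le> card U" by (rule matching_card_le_vertex_cover[OF M U(3)])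
      then show False using U(2) q by simp
    qed
  qed
qed

section \<open>The dimension formula\<close>

text \<open>
  Ordering the variables makes the monomials an ordered monoid, from which the polynomials in them
  inherit the absence of zero divisors.
\<close>

instantiation fan_vertex :: linorder
begin

fun rank :: "fan_vertex \<Rightarrow> nat" where
  "rank Hub = 0"
| "rank (Rim i) = Suc i"

definition less_eq_fan_vertex :: "fan_vertex \<Rightarrow> fan_vertex \<Rightarrow> bool" where
  "x \<le> y \<longleftrightarrow> rank x \<le> rank y"

definition less_fan_vertex :: "fan_vertex \<Rightarrow> fan_vertex \<Rightarrow> bool" where
  "x < y \<longleftrightarrow> rank x < rank y"

instance
proof
  fix x y :: fan_vertex
  assume "x \<le> y" "y \<le> x"
  then show "x = y" by (cases x; cases y) (auto simp: less_eq_fan_vertex_def)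
qed (auto simp: less_eq_fan_vertex_def less_fan_vertex_def)

end

lemma squarefree_power_eq_squarefree_ideal:
  "squarefree_power G q = squarefree_ideal (verts G) {\<Union>M | M. is_matching G q M}"
  unfolding squarefree_power_def squarefree_ideal_def by (rule arg_cong[where f = "genideal _"]) blast

theorem theorem7p5:
  fixes n :: nat
  assumes "n \<ge> 2"
  shows "int (matching_number (fan_graph n)) = \<lceil>real n / 2\<rceil>
    \<and> (\<forall>q. 1 \<le> q \<and> q \<le> matching_number (fan_graph n) \<longrightarrow>
          krull_dim (polynomial_ring (verts (fan_graph n)) Quot
            (squarefree_power (fan_graph n) q :: (fan_vertex, 'k::field) mpolynomial set))
          = enat (nat (\<lceil>real n / 2\<rceil> + int q - 1)))"
proof (intro conjI allI impI)
  have ceil: "\<lceil>real n / 2\<rceil> = int ((n + 1) div 2)"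
  proof (rule ceiling_unique)
    have "n \<le> 2 * ((n + 1) div 2)" "2 * ((n + 1) div 2) \<le> n + 1" by presburger+
    then have "real n \<le> real (2 * ((n + 1) div 2))" "real (2 * ((n + 1) div 2)) \<le> real (n + 1)"
      by (simp_all only: of_nat_le_iff)
    then show "real_of_int (int ((n + 1) div 2)) - 1 < real n / 2"
      "real n / 2 \<le> real_of_int (int ((n + 1) div 2))" by simp_all
  qed
  show "int (matching_number (fan_graph n)) = \<lceil>real n / 2\<rceil>"
    by (simp only: ceil matching_number_fan_graph)
  fix q assume "1 \<le> q \<and> q \<le> matching_number (fan_graph n)"
  then have q: "1 \<le> q" "q \<le> (n + 1) div 2" by (simp_all add: matching_number_fan_graph)
  let ?V = "verts (fan_graph n)" and ?\<A> = "{\<Union>M | M. is_matching (fan_graph n) q M}"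
  obtain W where W: "W \<subseteq> ?V" "card W = (n + 1) div 2 + q - 1"
    and free: "\<And>M. is_matching (fan_graph n) q M \<Longrightarrow> \<not> \<Union>M \<subseteq> W"
    by (rule large_matching_free_subset[OF q]) blast
  have "krull_dim (polynomial_ring ?V Quot (squarefree_ideal ?V ?\<A> :: (fan_vertex, 'k) mpolynomial set))
      = enat (card W)"
  proof (rule krull_dim_squarefree_quotient[OF finite_verts_fan_graph _ W(1)])
    show "A \<subseteq> ?V" if "A \<in> ?\<A>" for A
      using that fan_edge_subset by (fastforce simp: is_matching_def)
    show "\<not> A \<subseteq> W" if "A \<in> ?\<A>" for A using that free by blast
    fix U assume U: "U \<subseteq> ?V" "\<And>A. A \<in> ?\<A> \<Longrightarrow> \<not> A \<subseteq> U"
    have "\<not> (n + 1) div 2 + q \<le> card U"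
    proof
      assume "(n + 1) div 2 + q \<le> card U"
      then obtain M where "is_matching (fan_graph n) q M" "\<Union>M \<subseteq> U"
        by (rule large_subset_contains_fan_matching[OF U(1) q(2)])
      then show False using U(2) by blast
    qed
    then show "card U \<le> card W" using W(2) by simp
  qed
  moreover have "nat (\<lceil>real n / 2\<rceil> + int q - 1) = card W"
    unfolding ceil W(2) using q(1) by simp
  ultimately show "krull_dim (polynomial_ring ?V Quot
      (squarefree_power (fan_graph n) q :: (fan_vertex, 'k) mpolynomial set))
      = enat (nat (\<lceil>real n / 2\<rceil> + int q - 1))"
    by (simp only: squarefree_power_eq_squarefree_ideal)
qed

end
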